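(* Let $u \in \mathcal{W}_2$ be a word of length $n \ge 2$ with exactly two $1$'s, and let $i_1 < i_2$ be the indices of the two $1$'s. If $u$ is in $\mathcal{U}(\{0, 1\})$, then $$i_2-i_1 \le \frac{n}{2}.$$
   Context: $\mathcal{W}_2$ is the set of finite nonempty binary strings (words on the alphabet $\{0,1\}$), with multiplication $*$ given by concatenation; the size of a word is its length. The Ulam set $\mathcal{U}(\{0,1\})\subset\mathcal{W}_2$ is built as follows: first put the one-letter words $0$ and $1$ into it; then repeatedly add a shortest word not already in the set that can be written in exactly one way as a concatenation $v*w$ of two distinct words $v\neq w$ already in the set (representations are ordered pairs $(v,w)$). Ties among words of the same length may be broken arbitrarily without affecting the resulting set. Equivalently, a word $u$ of length at least $2$ is in $\mathcal{U}(\{0,1\})$ iff there is exactly one ordered pair $(v,w)$ of distinct elements of $\mathcal{U}(\{0,1\})$ with $u=v*w$. The index of a letter in a word is the number of letters to its left, including the letter itself (so indices run from $1$ to $n$). *)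

theory Defs
  imports Complex_Main "HOL-Library.Z2"
begin

text \<open>
  Binary words are lists over the two-element type \<^typ>\<open>bit\<close>, multiplied by \<open>@\<close>. Words are
  meant to be nonempty; this need not be imposed separately, as every element of the Ulam
  set is nonempty (\<open>ulam_word_nonempty\<close> and \<open>ulam_set_eq\<close> below).
\<close>

definition uniquely_representable :: "bit list set \<Rightarrow> bit list \<Rightarrow> bool" where
  "uniquely_representable S u \<longleftrightarrow>
     (\<exists>!(v, w). v \<in> S \<and> w \<in> S \<and> v \<noteq> w \<and> u = v @ w)"

text \<open>
  The sets reachable after finitely many steps of the construction, for all ways of breaking
  ties. A word that enters \<open>S\<close> only affects the representations of strictly longer words, so
  the union of all stages does not depend on the tie-breaking; \<open>ulam_set_iff\<close> below
  confirms this.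
\<close>

inductive ulam_stage :: "bit list set \<Rightarrow> bool" where
  init: "ulam_stage {[0], [1]}"
| step: "ulam_stage (insert u S)"
    if "ulam_stage S"
      and "u \<notin> S" and "uniquely_representable S u"
      and "\<And>x. x \<notin> S \<Longrightarrow> uniquely_representable S x \<Longrightarrow> length u \<le> length x"

definition ulam_set :: "bit list set" where
  "ulam_set = \<Union> {S. ulam_stage S}"

text \<open>Indices start at \<open>1\<close>, whereas \<open>!\<close> counts from \<open>0\<close>.\<close>

definition letter_indices :: "'a \<Rightarrow> 'a list \<Rightarrow> nat set" where
  "letter_indices a u = {i. 1 \<le> i \<and> i \<le> length u \<and> u ! (i - 1) = a}"

lemma uniquely_representable_cong:
  assumes "[] \<notin> S" "[] \<notin> T"
    and "\<And>x. length x < length u \<Longrightarrow> x \<in> S \<longleftrightarrow> x \<in> T"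
  shows "uniquely_representable S u \<longleftrightarrow> uniquely_representable T u"
proof -
  have "v \<in> S \<and> w \<in> S \<and> v \<noteq> w \<and> u = v @ w \<longleftrightarrow> v \<in> T \<and> w \<in> T \<and> v \<noteq> w \<and> u = v @ w" for v w
  proof (cases "u = v @ w \<and> v \<noteq> [] \<and> w \<noteq> []")
    case True
    then have "length v < length u" "length w < length u" by auto
    then show ?thesis using assms(3) by blast
  next
    case False
    then show ?thesis using assms(1,2) by metis
  qed
  then show ?thesis unfolding uniquely_representable_def by simp
qed

text \<open>The same set by recursion on the length, used to prove \<open>ulam_set_iff\<close>.\<close>

context
  notes conj_cong [fundef_cong]
begin

function ulam_word :: "bit list \<Rightarrow> bool" where
  "ulam_word u \<longleftrightarrow> length u = 1 \<or>
     uniquely_representable {x. x \<noteq> [] \<and> length x < length u \<and> ulam_word x} u"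
  by auto
termination by (relation "measure length") auto

end

declare ulam_word.simps [simp del]

lemma ulam_word_nonempty: "ulam_word u \<Longrightarrow> u \<noteq> []"
proof
  assume "ulam_word u" "u = []"
  then have "uniquely_representable {x. x \<noteq> [] \<and> length x < length u \<and> ulam_word x} []"
    using ulam_word.simps[of "[]"] by simp
  then show False unfolding uniquely_representable_def by auto
qed

lemma ulam_word_iff:
  "ulam_word u \<longleftrightarrow> length u = 1 \<or> uniquely_representable {x. ulam_word x} u"
proof -
  have "uniquely_representable {x. x \<noteq> [] \<and> length x < length u \<and> ulam_word x} u \<longleftrightarrow>
      uniquely_representable {x. ulam_word x} u"
    by (rule uniquely_representable_cong) (use ulam_word_nonempty in blast)+
  then show ?thesis using ulam_word.simps[of u] by blast
qed

lemma ulam_word_singleton: "ulam_word [a]"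
  using ulam_word.simps[of "[a]"] by simp

lemma length_one_bit: "length (x :: bit list) = 1 \<Longrightarrow> x \<in> {[0], [1]}"
proof -
  assume "length x = 1"
  then obtain a where "x = [a]" by (auto simp: length_Suc_conv)
  then show ?thesis by (cases "a = 0") simp_all
qed

lemma step_closed:
  assumes sub: "S \<subseteq> {x. ulam_word x}" and base: "{[0], [1]} \<subseteq> S"
    and min: "\<And>x. x \<notin> S \<Longrightarrow> uniquely_representable S x \<Longrightarrow> n \<le> length x"
    and "ulam_word x" "length x < n"
  shows "x \<in> S"
  using assms(4,5)
proof (induction x rule: measure_induct_rule[of length])
  case (less x)
  show ?case
  proof (cases "length x = 1")
    case True
    then show ?thesis using length_one_bit[of x] base by (meson subsetD)
  next
    case False
    have "y \<in> S \<longleftrightarrow> y \<in> {x. ulam_word x}" if "length y < length x" for y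
      using less.IH less.prems(2) sub that by (meson less_trans mem_Collect_eq subsetD)
    then have "uniquely_representable S x \<longleftrightarrow> uniquely_representable {x. ulam_word x} x"
      by (intro uniquely_representable_cong) (use sub ulam_word_nonempty in blast)+
    moreover have "uniquely_representable {x. ulam_word x} x"
      using False less.prems(1) ulam_word_iff[of x] by simp
    ultimately show ?thesis
      using min[of x] less.prems(2) by (meson not_le)
  qed
qed

lemma step_ulam_word:
  assumes sub: "S \<subseteq> {x. ulam_word x}" and base: "{[0], [1]} \<subseteq> S"
    and min: "\<And>x. x \<notin> S \<Longrightarrow> uniquely_representable S x \<Longrightarrow> length u \<le> length x"
    and u: "uniquely_representable S u"
  shows "ulam_word u"
proof -
  have "x \<in> S \<longleftrightarrow> x \<in> {x. ulam_word x}" if "length x < length u" for x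
    using step_closed[OF sub base min _ that] sub by blast
  then have "uniquely_representable S u \<longleftrightarrow> uniquely_representable {x. ulam_word x} u"
    by (intro uniquely_representable_cong) (use sub ulam_word_nonempty in blast)+
  then show ?thesis using u ulam_word_iff by blast
qed

lemma ulam_stage_sound:
  "ulam_stage S \<Longrightarrow> {[0], [1]} \<subseteq> S \<and> S \<subseteq> {x. ulam_word x}"
proof (induction rule: ulam_stage.induct)
  case init
  then show ?case by (simp add: ulam_word_singleton)
next
  case (step S u)
  then show ?case using step_ulam_word[of S u] by auto
qed

lemma ulam_stage_complete:
  assumes "ulam_stage S" "ulam_word x"
  shows "\<exists>S'. ulam_stage S' \<and> x \<in> S'"
  using assms(1)
proof (induction "card ({y. length y \<le> length x \<and> ulam_word y} - S)" arbitrary: S rule: less_induct)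
  case less
  let ?F = "{y. length y \<le> length x \<and> ulam_word y}"
  have "(UNIV :: bit set) = {0, 1}"
    using bit_not_one_iff by blast
  then have "finite (UNIV :: bit set)"
    by (metis finite.emptyI finite.insertI)
  from finite_lists_length_le[OF this, of "length x"] have fin: "finite ?F"
    by (rule finite_subset[rotated]) auto
  have inv: "S \<subseteq> {x. ulam_word x}" "{[0], [1]} \<subseteq> S"
    using ulam_stage_sound[OF less.prems] by auto
  show ?case
  proof (cases "x \<in> S")
    case True
    then show ?thesis using less.prems by blast
  next
    case False
    let ?C = "\<lambda>y. y \<notin> S \<and> uniquely_representable S y"
    have "\<exists>y. ?C y \<and> length y \<le> length x"
    proof (rule ccontr)
      assume "\<not> ?thesis"
      then have "\<And>y. ?C y \<Longrightarrow> Suc (length x) \<le> length y"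
        using not_less_eq_eq by blast
      then show False
        using step_closed[OF inv, of "Suc (length x)" x] False assms(2) by blast
    qed
    then obtain y where y: "?C y" "length y \<le> length x" by blast
    define u where "u = arg_min length ?C"
    have u: "?C u" and min: "\<And>z. ?C z \<Longrightarrow> length u \<le> length z"
      using arg_min_nat_lemma[of ?C y length] y unfolding u_def by auto
    have st: "ulam_stage (insert u S)"
      using ulam_stage.step[OF less.prems] u min by blast
    have "u \<in> ?F - S"
      using u min[OF y(1)] y(2) ulam_stage_sound[OF st] by auto
    then have "card (?F - insert u S) < card (?F - S)"
      by (intro psubset_card_mono) (use fin in auto)
    then show ?thesis using less.hyps st by blast
  qed
qed

lemma ulam_set_eq: "ulam_set = {x. ulam_word x}"
  unfolding ulam_set_def
  using ulam_stage_sound ulam_stage_complete[OF ulam_stage.init] by blast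

theorem ulam_set_iff:
  "u \<in> ulam_set \<longleftrightarrow> length u = 1 \<or> uniquely_representable ulam_set u"
  unfolding ulam_set_eq mem_Collect_eq by (rule ulam_word_iff)

end

theory Submission
  imports Defs
begin

text \<open>
  A word with exactly two \<open>1\<close>s has the form \<open>u = 0\<^sup>a 1 0\<^sup>b 1 0\<^sup>c\<close>, and the claim becomes \<open>b \<le> a + c\<close>.
  The Ulam words with few \<open>1\<close>s are easy to describe. The only one without a \<open>1\<close> is \<open>0\<close> itself, so
  a word \<open>0\<^sup>a 1 0\<^sup>s\<close> can only arise by attaching a single \<open>0\<close> on the left or on the right; ``exactly
  one representation'' is then Pascal's recurrence modulo 2, and \<open>0\<^sup>a 1 0\<^sup>s\<close> is an Ulam word iff
  \<open>(a + s) choose a\<close> is odd (\<open>one_one_ulam_iff\<close>), that is, iff \<open>a\<close> and \<open>s\<close> have no common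
  binary digit (\<open>odd_binomial_digit\<close>).

  Suppose \<open>b > a + c\<close>, and argue by induction on \<open>a + c\<close>. Removing an outer \<open>0\<close> from \<open>u\<close> keeps
  the inequality, so by induction no representation of \<open>u\<close> splits off a single \<open>0\<close>. What remains
  are the products of \<open>0\<^sup>a 1 0\<^sup>s\<close> and \<open>0\<^sup>t 1 0\<^sup>c\<close>, where \<open>s + t = b\<close>, \<open>s\<close> is digit-disjoint from \<open>a\<close>
  and \<open>t\<close> is digit-disjoint from \<open>c\<close>; the two factors differ, as \<open>b \<noteq> a + c\<close>. It
  therefore suffices that such a splitting of \<open>b\<close> is never unique when \<open>b > a + c\<close>
  (\<open>unique_split_bound\<close>). The reason is that digits can be moved: a digit of \<open>s\<close> missing from \<open>t\<close> may
  be handed over to \<open>t\<close> unless \<open>c\<close> has that digit, and vice versa; and a digit common to \<open>s\<close> and \<open>t\<close>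
  may be carried to the next position unless \<open>a\<close> and \<open>c\<close> block it there. A splitting
  without any such move forces \<open>a\<close> and \<open>c\<close> to have enough digits to make \<open>a + c \<ge> b\<close>.
\<close>

section \<open>Odd binomial coefficients\<close>

text \<open>The arguments are the two parts of the row index of Pascal's triangle, so that Pascal's
  recurrence lowers one of them, just as removing an outer \<open>0\<close> from \<open>0\<^sup>a 1 0\<^sup>s\<close> does.\<close>

definition odd_binomial :: "nat \<Rightarrow> nat \<Rightarrow> bool" where
  "odd_binomial a s \<longleftrightarrow> odd ((a + s) choose a)"

lemma odd_binomial_0 [simp]: "odd_binomial 0 s" "odd_binomial a 0"
  by (simp_all add: odd_binomial_def)

lemma odd_binomial_commute: "odd_binomial a s \<longleftrightarrow> odd_binomial s a"
  using binomial_symmetric[of a "a + s"] by (simp add: odd_binomial_def add.commute)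

lemma odd_binomial_Suc_Suc:
  "odd_binomial (Suc a) (Suc s) \<longleftrightarrow> odd_binomial a (Suc s) \<noteq> odd_binomial (Suc a) s"
  unfolding odd_binomial_def by auto

lemma odd_binomial_double:
  "odd_binomial (2 * a) (2 * s) \<longleftrightarrow> odd_binomial a s"
  "odd_binomial (Suc (2 * a)) (2 * s) \<longleftrightarrow> odd_binomial a s"
  "odd_binomial (2 * a) (Suc (2 * s)) \<longleftrightarrow> odd_binomial a s"
  "\<not> odd_binomial (Suc (2 * a)) (Suc (2 * s))"
proof (induction "a + s" arbitrary: a s rule: less_induct)
  case less
  have even: "odd_binomial (2 * a) (2 * s) \<longleftrightarrow> odd_binomial a s"
  proof (cases "a = 0 \<or> s = 0")
    case False
    then obtain a' s' where [simp]: "a = Suc a'" "s = Suc s'"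
      by (metis not0_implies_Suc)
    show ?thesis
      using less(2)[of a' s] less(3)[of a s'] by (simp add: odd_binomial_Suc_Suc)
  qed auto
  have right: "odd_binomial (2 * a) (Suc (2 * s)) \<longleftrightarrow> odd_binomial a s"
  proof (cases a)
    case (Suc a')
    then show ?thesis
      using less(4)[of a' s] even by (simp add: odd_binomial_Suc_Suc)
  qed simp
  have left: "odd_binomial (Suc (2 * a)) (2 * s) \<longleftrightarrow> odd_binomial a s"
  proof (cases s)
    case (Suc s')
    then show ?thesis
      using less(4)[of a s'] even by (simp add: odd_binomial_Suc_Suc)
  qed simp
  show "odd_binomial (2 * a) (2 * s) \<longleftrightarrow> odd_binomial a s"
    "odd_binomial (Suc (2 * a)) (2 * s) \<longleftrightarrow> odd_binomial a s"
    "odd_binomial (2 * a) (Suc (2 * s)) \<longleftrightarrow> odd_binomial a s"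
    "\<not> odd_binomial (Suc (2 * a)) (Suc (2 * s))"
    using even left right by (simp_all add: odd_binomial_Suc_Suc)
qed

text \<open>Iterating this lemma shows that \<open>odd_binomial\<close> is digit-disjointness in base 2 (a case of
  Kummer's and Lucas's theorems); the digit-wise form is the one suited to induction.\<close>

lemma odd_binomial_digit:
  assumes "d \<in> {0, 1}" "e \<in> {0, 1}"
  shows "odd_binomial (2 * a + d) (2 * s + e) \<longleftrightarrow> \<not> (d = 1 \<and> e = 1) \<and> odd_binomial a s"
  using assms by (auto simp: odd_binomial_double)

text \<open>
  The induction removes the last binary digit of all four numbers. A last digit common to \<open>s\<close> and
  \<open>t\<close> asks for more than the first claim of the higher digits: uniqueness then also excludes
  that the higher part of \<open>s + t\<close> plus a carry can be split. The second claim covers this situation.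
  Its bound \<open>s + t + 2\<close>, rather than the weaker \<open>s + t + 1\<close> that would suffice for the first
  claim, is what survives another common digit.
\<close>

lemma unique_split_bound:
  assumes "odd_binomial a s" "odd_binomial c t"
    and "\<And>x y. x + y = s + t \<Longrightarrow> odd_binomial a x \<Longrightarrow> odd_binomial c y \<Longrightarrow> x = s"
  shows "s + t \<le> a + c \<and>
    ((\<forall>x y. x + y = Suc (s + t) \<longrightarrow> \<not> (odd_binomial a x \<and> odd_binomial c y)) \<longrightarrow>
      s + t + 2 \<le> a + c)"
  using assms
proof (induction "a + c + s + t" arbitrary: a c s t rule: less_induct)
  case less
  show ?case
  proof (cases "a + c + s + t = 0")
    case True
    then have "1 + 0 = Suc (s + t) \<and> odd_binomial a 1 \<and> odd_binomial c 0" by simp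
    moreover have "s + t \<le> a + c" using True by simp
    ultimately show ?thesis by blast
  next
    case False
    define a' c' s' t' where up: "a' = a div 2" "c' = c div 2" "s' = s div 2" "t' = t div 2"
    define i j k l where lo: "i = a mod 2" "j = c mod 2" "k = s mod 2" "l = t mod 2"
    have eqs: "a = 2 * a' + i" "c = 2 * c' + j" "s = 2 * s' + k" "t = 2 * t' + l"
      unfolding up lo by simp_all
    have dig: "i \<in> {0, 1}" "j \<in> {0, 1}" "k \<in> {0, 1}" "l \<in> {0, 1}"
      unfolding lo by auto
    have a_iff: "odd_binomial a (2 * x + e) \<longleftrightarrow> \<not> (i = 1 \<and> e = 1) \<and> odd_binomial a' x"
      if "e \<in> {0, 1}" for x e
      unfolding eqs(1) using odd_binomial_digit dig(1) that by blast
    have c_iff: "odd_binomial c (2 * x + e) \<longleftrightarrow> \<not> (j = 1 \<and> e = 1) \<and> odd_binomial c' x"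
      if "e \<in> {0, 1}" for x e
      unfolding eqs(2) using odd_binomial_digit dig(2) that by blast
    have s: "\<not> (i = 1 \<and> k = 1)" "odd_binomial a' s'"
      using less.prems(1) a_iff[OF dig(3)] unfolding eqs(3) by auto
    have t: "\<not> (j = 1 \<and> l = 1)" "odd_binomial c' t'"
      using less.prems(2) c_iff[OF dig(4)] unfolding eqs(4) by auto
    note uniq = less.prems(3)
    have uniq': "x = s'" if "x + y = s' + t'" "odd_binomial a' x" "odd_binomial c' y" for x y
    proof -
      have "2 * x + k = s"
        by (rule uniq[of _ "2 * y + l"])
          (use that s t a_iff[OF dig(3)] c_iff[OF dig(4)] eqs in auto)
      then show ?thesis using eqs by simp
    qed
    have "a' + c' + s' + t' < a + c + s + t"
      using False unfolding up by linarith
    from less.hyps[OF this s(2) t(2)] uniq'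
    have IH: "s' + t' \<le> a' + c'"
      and IH_carry: "(\<And>x y. x + y = Suc (s' + t') \<Longrightarrow> odd_binomial a' x \<Longrightarrow> odd_binomial c' y \<Longrightarrow> False)
        \<Longrightarrow> s' + t' + 2 \<le> a' + c'"
      by blast+
    \<comment> \<open>A splitting of the higher part plus a carry yields one with both last digits \<open>0\<close>.\<close>
    have even: "odd_binomial a (2 * x)" "odd_binomial c (2 * y)"
      if "odd_binomial a' x" "odd_binomial c' y" for x y
      using a_iff[of 0 x] c_iff[of 0 y] that by auto
    consider (none) "k = 0" "l = 0" | (left) "k = 1" "l = 0" | (right) "k = 0" "l = 1"
      | (both) "k = 1" "l = 1"
      using dig by auto
    then show ?thesis
    proof cases
      case none
      \<comment> \<open>Otherwise the extra unit in \<open>s + t + 1\<close> could become the last digit of \<open>s\<close> or of \<open>t\<close>.\<close>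
      have "i = 1 \<and> j = 1"
        if no: "\<forall>x y. x + y = Suc (s + t) \<longrightarrow> \<not> (odd_binomial a x \<and> odd_binomial c y)"
      proof -
        have "\<not> (odd_binomial a (2 * s' + 1) \<and> odd_binomial c (2 * t' + 0))"
          "\<not> (odd_binomial a (2 * s' + 0) \<and> odd_binomial c (2 * t' + 1))"
          using no none eqs by auto
        then show ?thesis
          using a_iff[of 1 s'] a_iff[of 0 s'] c_iff[of 0 t'] c_iff[of 1 t'] s t by auto
      qed
      then show ?thesis using IH none eqs by auto
    next
      case left
      \<comment> \<open>Otherwise the last digit could be handed over from \<open>s\<close> to \<open>t\<close>.\<close>
      have "j = 1"
      proof (rule ccontr)
        assume "j \<noteq> 1"
        then have "2 * s' + 0 = s"
          by (intro uniq[of _ "2 * t' + 1"])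
            (use left s t a_iff[of 0 s'] c_iff[of 1 t'] eqs in auto)
        then show False using left eqs by simp
      qed
      moreover have "s' + t' + 2 \<le> a' + c'"
        if no: "\<forall>x y. x + y = Suc (s + t) \<longrightarrow> \<not> (odd_binomial a x \<and> odd_binomial c y)"
      proof (rule IH_carry)
        fix x y assume "x + y = Suc (s' + t')" "odd_binomial a' x" "odd_binomial c' y"
        then show False using no[rule_format, of "2 * x" "2 * y"] even left eqs by auto
      qed
      ultimately show ?thesis using IH left eqs by auto
    next
      case right
      \<comment> \<open>Otherwise the last digit could be handed over from \<open>t\<close> to \<open>s\<close>.\<close>
      have "i = 1"
      proof (rule ccontr)
        assume "i \<noteq> 1"
        then have "2 * s' + 1 = s"
          by (intro uniq[of _ "2 * t' + 0"])
            (use right s t a_iff[of 1 s'] c_iff[of 0 t'] eqs in auto)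
        then show False using right eqs by simp
      qed
      moreover have "s' + t' + 2 \<le> a' + c'"
        if no: "\<forall>x y. x + y = Suc (s + t) \<longrightarrow> \<not> (odd_binomial a x \<and> odd_binomial c y)"
      proof (rule IH_carry)
        fix x y assume "x + y = Suc (s' + t')" "odd_binomial a' x" "odd_binomial c' y"
        then show False using no[rule_format, of "2 * x" "2 * y"] even right eqs by auto
      qed
      ultimately show ?thesis using IH right eqs by auto
    next
      case both
      \<comment> \<open>The two last digits \<open>1\<close> could be carried into a splitting of the higher part.\<close>
      have "s' + t' + 2 \<le> a' + c'"
      proof (rule IH_carry)
        fix x y assume "x + y = Suc (s' + t')" "odd_binomial a' x" "odd_binomial c' y"
        then have "2 * x = s" by (intro uniq[of _ "2 * y"]) (use even both eqs in auto)
        then show False using both eqs by presburger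
      qed
      then show ?thesis using both eqs by auto
    qed
  qed
qed

section \<open>Factorizations of words with few ones\<close>

lemma uniquely_representable_iff_singleton:
  "uniquely_representable S u \<longleftrightarrow>
    (\<exists>p. {(v, w). v \<in> S \<and> w \<in> S \<and> v \<noteq> w \<and> u = v @ w} = {p})"
proof -
  have "(\<exists>!p. P p) \<longleftrightarrow> (\<exists>p. Collect P = {p})" for P :: "bit list \<times> bit list \<Rightarrow> bool"
    unfolding Ex1_def set_eq_iff by (simp, metis)
  then show ?thesis unfolding uniquely_representable_def .
qed

lemma uniquely_representableE:
  assumes "uniquely_representable S u"
  obtains v w where "v \<in> S" "w \<in> S" "v \<noteq> w" "u = v @ w"
    and "\<forall>v' w'. v' \<in> S \<and> w' \<in> S \<and> v' \<noteq> w' \<and> u = v' @ w' \<longrightarrow> v' = v \<and> w' = w"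
proof -
  let ?R = "{(v, w). v \<in> S \<and> w \<in> S \<and> v \<noteq> w \<and> u = v @ w}"
  obtain p where "?R = {p}"
    using assms unfolding uniquely_representable_iff_singleton by (rule exE)
  then obtain v w where R: "?R = {(v, w)}" by (cases p) simp
  show thesis
  proof (rule that[of v w])
    have "(v, w) \<in> ?R" unfolding R by simp
    then show "v \<in> S" "w \<in> S" "v \<noteq> w" "u = v @ w" by simp_all
  next
    have "(v', w') = (v, w)" if "(v', w') \<in> ?R" for v' w'
      using that unfolding R by simp
    then show "\<forall>v' w'. v' \<in> S \<and> w' \<in> S \<and> v' \<noteq> w' \<and> u = v' @ w' \<longrightarrow> v' = v \<and> w' = w"
      by blast
  qed
qed

abbreviation zeros :: "nat \<Rightarrow> bit list" where
  "zeros k \<equiv> replicate k 0"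

definition one_one_word :: "nat \<Rightarrow> nat \<Rightarrow> bit list" where
  "one_one_word a s = zeros a @ 1 # zeros s"

definition two_ones_word :: "nat \<Rightarrow> nat \<Rightarrow> nat \<Rightarrow> bit list" where
  "two_ones_word a b c = zeros a @ 1 # zeros b @ 1 # zeros c"

lemma append_eq_zerosE:
  assumes "v @ w = zeros b"
  obtains s t where "s + t = b" "v = zeros s" "w = zeros t"
  using assms by (metis append_eq_conv_conj drop_replicate length_append length_replicate
      take_replicate)

lemma append_eq_zeros_oneE:
  assumes "v @ w = zeros a @ 1 # r"
  obtains (before) k l where "k + l = a" "v = zeros k" "w = zeros l @ 1 # r"
    | (after) p where "v = zeros a @ 1 # p" "p @ w = r"
proof -
  from assms consider (1) us where "zeros a = v @ us" "us @ 1 # r = w"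
    | (2) us where "v = zeros a @ us" "us @ w = 1 # r"
    by (metis append_eq_append_conv2)
  then show ?thesis
  proof cases
    case 1
    then obtain k l where "k + l = a" "v = zeros k" "us = zeros l"
      using append_eq_zerosE[of v us a] by metis
    then show ?thesis using before 1 by blast
  next
    case 2
    show ?thesis
    proof (cases us)
      case Nil
      then show ?thesis using before[of a 0] 2 by simp
    next
      case (Cons b p)
      then show ?thesis using after[of p] 2 by simp
    qed
  qed
qed

lemma one_one_word_eq_iff [simp]:
  "one_one_word a s = one_one_word a' s' \<longleftrightarrow> a = a' \<and> s = s'"
proof
  assume eq: "one_one_word a s = one_one_word a' s'"
  then have "takeWhile (\<lambda>x. x = 0) (one_one_word a s) = takeWhile (\<lambda>x. x = 0) (one_one_word a' s')"
    by simp
  then have "a = a'"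
    by (simp add: one_one_word_def takeWhile_append)
  moreover have "a + s = a' + s'"
    using arg_cong[OF eq, of length] by (simp add: one_one_word_def)
  ultimately show "a = a' \<and> s = s'" by simp
qed simp

lemma one_one_word_neq_0 [simp]: "one_one_word a s \<noteq> [0]" "[0] \<noteq> one_one_word a s"
proof -
  have "1 \<in> set (one_one_word a s)" "1 \<notin> set [0 :: bit]"
    by (simp_all add: one_one_word_def)
  then show "one_one_word a s \<noteq> [0]" "[0] \<noteq> one_one_word a s" by metis+
qed

lemma zero_append_one_one_word: "[0] @ one_one_word a s = one_one_word (Suc a) s"
  by (simp add: one_one_word_def)

lemma one_one_word_append_zero: "one_one_word a s @ [0] = one_one_word a (Suc s)"
  by (simp add: one_one_word_def replicate_append_same)

lemma one_one_word_append: "one_one_word a s @ one_one_word t c = two_ones_word a (s + t) c"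
  by (simp add: one_one_word_def two_ones_word_def replicate_add)

section \<open>Ulam words with at most one one\<close>

lemma zeros_ulam_iff: "zeros k \<in> ulam_set \<longleftrightarrow> k = 1"
proof (induction k rule: less_induct)
  case (less k)
  show ?case
  proof (cases "k = 1")
    case True
    then show ?thesis by (simp add: ulam_set_iff)
  next
    case False
    \<comment> \<open>By induction both factors would be the word \<open>0\<close>, but factors have to be distinct.\<close>
    have False if "zeros k \<in> ulam_set"
    proof -
      have "uniquely_representable ulam_set (zeros k)"
        using that False ulam_set_iff by simp
      then obtain v w where vw: "v \<in> ulam_set" "w \<in> ulam_set" "v \<noteq> w" "v @ w = zeros k"
        by (elim uniquely_representableE) metis
      then obtain s t where st: "s + t = k" "v = zeros s" "w = zeros t"
        using append_eq_zerosE by metis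
      have "v \<noteq> []" "w \<noteq> []"
        using vw ulam_set_eq ulam_word_nonempty by auto
      then have "s < k" "t < k" using st by auto
      then show False using less.IH vw st by metis
    qed
    then show ?thesis using False by blast
  qed
qed

lemma zero_ulam: "[0] \<in> ulam_set"
  using zeros_ulam_iff[of 1] by simp

text \<open>One of the two factors contains no \<open>1\<close>, and is therefore the word \<open>0\<close>.\<close>

lemma one_one_word_representations:
  "{(v, w). v \<in> ulam_set \<and> w \<in> ulam_set \<and> v \<noteq> w \<and> one_one_word a s = v @ w} =
    {([0], one_one_word a' s) | a'. a = Suc a' \<and> one_one_word a' s \<in> ulam_set} \<union>
    {(one_one_word a s', [0]) | s'. s = Suc s' \<and> one_one_word a s' \<in> ulam_set}"
  (is "?L = ?R")
proof (intro equalityI subrelI)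
  fix v w assume "(v, w) \<in> ?L"
  then have vw: "v \<in> ulam_set" "w \<in> ulam_set" "v @ w = zeros a @ 1 # zeros s"
    by (simp_all add: one_one_word_def)
  from vw(3) show "(v, w) \<in> ?R"
  proof (cases rule: append_eq_zeros_oneE)
    case (before k l)
    then have "k = 1" using vw zeros_ulam_iff by blast
    then show ?thesis using before vw by (simp add: one_one_word_def)
  next
    case (after p)
    then obtain x y where xy: "x + y = s" "p = zeros x" "w = zeros y"
      using append_eq_zerosE by metis
    then have "y = 1" using vw zeros_ulam_iff by blast
    then show ?thesis using after xy vw by (simp add: one_one_word_def)
  qed
next
  fix v w assume "(v, w) \<in> ?R"
  then consider (left) a' where "a = Suc a'" "one_one_word a' s \<in> ulam_set"
      "v = [0]" "w = one_one_word a' s"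
    | (right) s' where "s = Suc s'" "one_one_word a s' \<in> ulam_set"
      "v = one_one_word a s'" "w = [0]"
    by blast
  then show "(v, w) \<in> ?L"
  proof cases
    case left
    then show ?thesis using zero_ulam zero_append_one_one_word[of a' s] by simp
  next
    case right
    then show ?thesis using zero_ulam one_one_word_append_zero[of a s'] by simp
  qed
qed

lemma one_one_ulam_iff: "one_one_word a s \<in> ulam_set \<longleftrightarrow> odd_binomial a s"
proof (induction "a + s" arbitrary: a s rule: less_induct)
  case less
  show ?case
  proof (cases "a + s = 0")
    case True
    then show ?thesis by (simp add: ulam_set_iff one_one_word_def)
  next
    case False
    let ?L = "{([0], one_one_word a' s) | a'. a = Suc a' \<and> odd_binomial a' s}"
    let ?R = "{(one_one_word a s', [0]) | s'. s = Suc s' \<and> odd_binomial a s'}"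
    have LR: "{([0], one_one_word a' s) | a'. a = Suc a' \<and> one_one_word a' s \<in> ulam_set} = ?L"
      "{(one_one_word a s', [0]) | s'. s = Suc s' \<and> one_one_word a s' \<in> ulam_set} = ?R"
    proof -
      have "one_one_word a' s \<in> ulam_set \<longleftrightarrow> odd_binomial a' s" if "a = Suc a'" for a'
        by (rule less.hyps) (simp add: that)
      then show "{([0], one_one_word a' s) | a'. a = Suc a' \<and> one_one_word a' s \<in> ulam_set} = ?L"
        by blast
      have "one_one_word a s' \<in> ulam_set \<longleftrightarrow> odd_binomial a s'" if "s = Suc s'" for s'
        by (rule less.hyps) (simp add: that)
      then show "{(one_one_word a s', [0]) | s'. s = Suc s' \<and> one_one_word a s' \<in> ulam_set} = ?R"
        by blast
    qed
    have "length (one_one_word a s) \<noteq> 1" using False by (simp add: one_one_word_def)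
    then have "one_one_word a s \<in> ulam_set \<longleftrightarrow> uniquely_representable ulam_set (one_one_word a s)"
      using ulam_set_iff by blast
    also have "\<dots> \<longleftrightarrow> (\<exists>p. ?L \<union> ?R = {p})"
      unfolding uniquely_representable_iff_singleton one_one_word_representations LR ..
    also have "\<dots> \<longleftrightarrow> odd_binomial a s"
    proof (cases a)
      case 0
      then obtain s' where "s = Suc s'" using False by (cases s) auto
      then have "?L \<union> ?R = {(one_one_word a s', [0])}" using 0 by simp
      then show ?thesis using 0 by simp
    next
      case a: (Suc a')
      show ?thesis
      proof (cases s)
        case 0
        then have "?L \<union> ?R = {([0], one_one_word a' s)}" using a by simp
        then show ?thesis using 0 by simp
      next
        case s: (Suc s')
        have L: "?L = (if odd_binomial a' s then {([0], one_one_word a' s)} else {})"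
          using a by simp
        have R: "?R = (if odd_binomial a s' then {(one_one_word a s', [0])} else {})"
          using s by simp
        have "odd_binomial a s \<longleftrightarrow> odd_binomial a' s \<noteq> odd_binomial a s'"
          unfolding a s by (rule odd_binomial_Suc_Suc)
        then show ?thesis unfolding L R by simp
      qed
    qed
    finally show ?thesis .
  qed
qed

section \<open>Ulam words with two ones\<close>

text \<open>In the unique representation of a counterexample neither factor is \<open>0\<close>, since the other factor
  would be a smaller counterexample. So the cut lies between the two \<open>1\<close>s, and any other admissible
  splitting of \<open>b\<close> would be a second representation.\<close>

lemma two_ones_ulam_bound:
  assumes "two_ones_word a b c \<in> ulam_set"
  shows "b \<le> a + c"
  using assms
proof (induction "a + c" arbitrary: a c rule: less_induct)
  case less
  show ?case
  proof (rule ccontr)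
    assume gt: "\<not> b \<le> a + c"
    have "uniquely_representable ulam_set (two_ones_word a b c)"
      using less.prems ulam_set_iff[of "two_ones_word a b c"] by (simp add: two_ones_word_def)
    then obtain v w where vw: "v \<in> ulam_set" "w \<in> ulam_set" "v \<noteq> w" "two_ones_word a b c = v @ w"
      and uniq: "\<forall>v' w'. v' \<in> ulam_set \<and> w' \<in> ulam_set \<and> v' \<noteq> w' \<and>
        two_ones_word a b c = v' @ w' \<longrightarrow> v' = v \<and> w' = w"
      by (rule uniquely_representableE)
    have "v @ w = zeros a @ 1 # zeros b @ 1 # zeros c"
      using vw(4) by (simp add: two_ones_word_def)
    then show False
    proof (cases rule: append_eq_zeros_oneE)
      case (before k l)
      then have "k = 1" using vw zeros_ulam_iff by blast
      then show False
        using less.hyps[of l c] before vw gt by (auto simp: two_ones_word_def)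
    next
      case (after p)
      note p = after
      from p(2) show False
      proof (cases rule: append_eq_zeros_oneE)
        case (before s t)
        have v: "v = one_one_word a s" and w: "w = one_one_word t c"
          using p before by (simp_all add: one_one_word_def)
        have "odd_binomial a s" "odd_binomial c t"
          using vw(1,2) one_one_ulam_iff odd_binomial_commute[of c t] unfolding v w by blast+
        moreover have "x = s"
          if xy: "x + y = s + t" "odd_binomial a x" "odd_binomial c y" for x y
        proof -
          have "odd_binomial y c"
            using xy(3) odd_binomial_commute by blast
          \<comment> \<open>Equal factors would mean \<open>y = a\<close> and \<open>x = c\<close>, hence \<open>b = a + c\<close>.\<close>
          moreover have "one_one_word a x \<noteq> one_one_word y c"
            using xy(1) before(1) gt by auto
          moreover have "two_ones_word a b c = one_one_word a x @ one_one_word y c"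
            using xy(1) before(1) by (simp add: one_one_word_append)
          ultimately have "one_one_word a x = v"
            using uniq xy(2) one_one_ulam_iff by blast
          then show ?thesis using v by simp
        qed
        ultimately have "s + t \<le> a + c" using unique_split_bound[of a s c t] by blast
        then show False using before(1) gt by simp
      next
        case (after q)
        then obtain x y where xy: "x + y = c" "q = zeros x" "w = zeros y"
          using append_eq_zerosE by metis
        then have "y = 1" using vw zeros_ulam_iff by blast
        then show False
          using less.hyps[of a x] after p xy vw gt by (auto simp: two_ones_word_def)
      qed
    qed
  qed
qed

lemma two_ones_word_of_indices:
  assumes "i1 < i2" and ind: "letter_indices 1 u = {i1, i2}"
  shows "1 \<le> i1 \<and> i2 \<le> length u \<and>
    u = two_ones_word (i1 - 1) (i2 - i1 - 1) (length u - i2)"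
proof -
  have "i1 \<in> letter_indices 1 u" "i2 \<in> letter_indices 1 u" using ind by auto
  then have bounds: "1 \<le> i1" "i2 \<le> length u" by (auto simp: letter_indices_def)
  have "u = two_ones_word (i1 - 1) (i2 - i1 - 1) (length u - i2)"
  proof (rule nth_equalityI)
    show "length u = length (two_ones_word (i1 - 1) (i2 - i1 - 1) (length u - i2))"
      using bounds assms(1) by (simp add: two_ones_word_def)
  next
    fix k assume k: "k < length u"
    have "u ! k = 1 \<longleftrightarrow> Suc k \<in> letter_indices 1 u"
      using k by (simp add: letter_indices_def)
    then have one: "u ! k = 1 \<longleftrightarrow> Suc k = i1 \<or> Suc k = i2" using ind by simp
    then have "u ! k = (if Suc k = i1 \<or> Suc k = i2 then 1 else 0)"
      by (metis bit_not_one_iff)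
    also have "\<dots> = two_ones_word (i1 - 1) (i2 - i1 - 1) (length u - i2) ! k"
      using k bounds assms(1)
      by (auto simp: two_ones_word_def nth_append nth_Cons split: nat.split)
    finally show "u ! k = two_ones_word (i1 - 1) (i2 - i1 - 1) (length u - i2) ! k" .
  qed
  then show ?thesis using bounds by blast
qed

theorem theorem3p7:
  fixes u :: "bit list" and n i1 i2 :: nat
  assumes "length u = n" and "n \<ge> 2"
    and "i1 < i2" and "letter_indices 1 u = {i1, i2}"
    and "u \<in> ulam_set"
  shows "real i2 - real i1 \<le> real n / 2"
proof -
  have "1 \<le> i1" "i2 \<le> n" "u = two_ones_word (i1 - 1) (i2 - i1 - 1) (n - i2)"
    using two_ones_word_of_indices[OF assms(3,4)] assms(1) by auto
  then have "i2 - i1 - 1 \<le> i1 - 1 + (n - i2)"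
    using two_ones_ulam_bound assms(5) by metis
  then have "2 * i2 \<le> 2 * i1 + n"
    using \<open>1 \<le> i1\<close> \<open>i2 \<le> n\<close> assms(3) by linarith
  then show ?thesis by linarith
qed

end
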